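(* Let $U\subseteq\mathbf{R}^d$ be open, $\tau>0$ and $\sigma>1$. Then each of the classes $\mathcal{E}_{\{\tau,\sigma\}}(U)$ and $\mathcal{E}_{(\tau,\sigma)}(U)$ is inverse-closed in $C^\infty(U)$.
   Context: An algebra $\mathcal{A}\subseteq C^\infty(U)$ is inverse-closed in $C^\infty(U)$ if for any $\varphi\in\mathcal{A}$ with $\varphi(x)\neq0$ for all $x\in U$ it follows that $\varphi^{-1}=1/\varphi\in\mathcal{A}$. $\mathbf{N}$ denotes the nonnegative integers. Put $M_p^{\tau,\sigma}=p^{\tau p^{\sigma}}$ for $p\ge1$ and $M_0^{\tau,\sigma}=1$. For $h>0$ and a regular compact set $K\subset\mathbf{R}^d$, $\mathcal{E}_{\tau,\sigma,h}(K)$ is the Banach space of functions $\phi\in C^\infty(K)$ with $$\|\phi\|_{\mathcal{E}_{\tau,\sigma,h}(K)}=\sup_{\alpha\in\mathbf{N}^d}\sup_{x\in K}\frac{|\partial^\alpha\phi(x)|}{h^{|\alpha|^\sigma}M_{|\alpha|}^{\tau,\sigma}}<\infty .$$ $\mathcal{E}_{\{\tau,\sigma\}}(U)=\varprojlim_{K\subset\subset U}\varinjlim_{h\to\infty}\mathcal{E}_{\tau,\sigma,h}(K)$, i.e. $\phi\in C^\infty(U)$ belongs to it iff for every compact $K\subset\subset U$ there is $h>0$ with $\|\phi\|_{\mathcal{E}_{\tau,\sigma,h}(K)}<\infty$; $\mathcal{E}_{(\tau,\sigma)}(U)=\varprojlim_{K\subset\subset U}\varprojlim_{h\to0}\mathcal{E}_{\tau,\sigma,h}(K)$,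 i.e. $\phi\in C^\infty(U)$ belongs to it iff $\|\phi\|_{\mathcal{E}_{\tau,\sigma,h}(K)}<\infty$ for every compact $K\subset\subset U$ and every $h>0$. *)

theory Defs
  imports "HOL-Analysis.Analysis"
begin

text \<open>
  A function on an open set \<open>U \<subseteq> \<real>\<^sup>d\<close> is represented by a total function on \<^typ>\<open>real ^ 'n\<close>; its
  values outside \<open>U\<close> are irrelevant for everything below. The scalars \<^typ>\<open>'a :: real_normed_field\<close>
  cover both real-valued and complex-valued functions.
\<close>

definition partial_deriv ::
    "'n \<Rightarrow> (real ^ 'n \<Rightarrow> 'a) \<Rightarrow> real ^ 'n \<Rightarrow> 'a::real_normed_field" where
  "partial_deriv i f x = vector_derivative (\<lambda>t. f (x + t *\<^sub>R axis i 1)) (at 0)"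

primrec iter_partial ::
    "'n list \<Rightarrow> (real ^ 'n \<Rightarrow> 'a) \<Rightarrow> real ^ 'n \<Rightarrow> 'a::real_normed_field" where
  "iter_partial [] f = f"
| "iter_partial (i # is) f = partial_deriv i (iter_partial is f)"

text \<open>
  \<open>C\<^sup>\<infinity>(U)\<close>: the partial derivatives of all orders, taken in any succession, exist and are
  continuous. Existence is stated separately because \<^const>\<open>vector_derivative\<close> is total.
\<close>

definition smooth_functions ::
    "(real ^ 'n) set \<Rightarrow> (real ^ 'n \<Rightarrow> 'a::real_normed_field) set" where
  "smooth_functions U = {f. \<forall>is.
     continuous_on U (iter_partial is f) \<and>
     (\<forall>i. \<forall>x\<in>U. (\<lambda>t. iter_partial is f (x + t *\<^sub>R axis i 1)) differentiable (at 0))}"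

text \<open>
  \<open>\<partial>\<^sup>\<alpha>\<close> differentiates \<open>\<alpha> i\<close> times in direction \<open>i\<close>. The index type carries no order, so the
  succession is a fixed but arbitrary one; on \<^const>\<open>smooth_functions\<close> it makes no difference, by
  the symmetry of mixed partial derivatives.
\<close>

definition multi_deriv ::
    "('n \<Rightarrow> nat) \<Rightarrow> (real ^ 'n \<Rightarrow> 'a) \<Rightarrow> real ^ 'n \<Rightarrow> 'a::real_normed_field" where
  "multi_deriv \<alpha> = iter_partial (SOME is. \<forall>i. count_list is i = \<alpha> i)"

definition multi_order :: "('n::finite \<Rightarrow> nat) \<Rightarrow> nat" where
  "multi_order \<alpha> = (\<Sum>i\<in>UNIV. \<alpha> i)"

text \<open>The case \<open>p = 0\<close> is separate because \<^term>\<open>0 powr 0 = (0::real)\<close>.\<close>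

definition M_seq :: "real \<Rightarrow> real \<Rightarrow> nat \<Rightarrow> real" where
  "M_seq \<tau> \<sigma> p = (if p = 0 then 1 else real p powr (\<tau> * real p powr \<sigma>))"

definition E_norm ::
    "real \<Rightarrow> real \<Rightarrow> real \<Rightarrow> (real ^ 'n) set \<Rightarrow> (real ^ 'n \<Rightarrow> 'a::real_normed_field) \<Rightarrow> ennreal" where
  "E_norm \<tau> \<sigma> h K \<phi> =
     (SUP \<alpha>. SUP x\<in>K.
        ennreal (norm (multi_deriv \<alpha> \<phi> x) /
          (h powr (real (multi_order \<alpha>) powr \<sigma>) * M_seq \<tau> \<sigma> (multi_order \<alpha>))))"

definition E_Roumieu ::
    "real \<Rightarrow> real \<Rightarrow> (real ^ 'n) set \<Rightarrow> (real ^ 'n \<Rightarrow> 'a::real_normed_field) set" where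
  "E_Roumieu \<tau> \<sigma> U = {\<phi> \<in> smooth_functions U.
     \<forall>K. compact K \<and> K \<subseteq> U \<longrightarrow> (\<exists>h>0. E_norm \<tau> \<sigma> h K \<phi> < \<infinity>)}"

definition E_Beurling ::
    "real \<Rightarrow> real \<Rightarrow> (real ^ 'n) set \<Rightarrow> (real ^ 'n \<Rightarrow> 'a::real_normed_field) set" where
  "E_Beurling \<tau> \<sigma> U = {\<phi> \<in> smooth_functions U.
     \<forall>K. compact K \<and> K \<subseteq> U \<longrightarrow> (\<forall>h>0. E_norm \<tau> \<sigma> h K \<phi> < \<infinity>)}"

definition function_algebra :: "('b \<Rightarrow> 'a::real_normed_field) set \<Rightarrow> bool" where
  "function_algebra A \<longleftrightarrow>
     (\<lambda>x. 0) \<in> A \<and>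
     (\<forall>f\<in>A. \<forall>g\<in>A. (\<lambda>x. f x + g x) \<in> A) \<and>
     (\<forall>c. \<forall>f\<in>A. (\<lambda>x. c * f x) \<in> A) \<and>
     (\<forall>f\<in>A. \<forall>g\<in>A. (\<lambda>x. f x * g x) \<in> A)"

definition inverse_closed_in_smooth ::
    "(real ^ 'n) set \<Rightarrow> (real ^ 'n \<Rightarrow> 'a::real_normed_field) set \<Rightarrow> bool" where
  "inverse_closed_in_smooth U A \<longleftrightarrow>
     A \<subseteq> smooth_functions U \<and> function_algebra A \<and>
     (\<forall>\<phi>\<in>A. (\<forall>x\<in>U. \<phi> x \<noteq> 0) \<longrightarrow> (\<lambda>x. 1 / \<phi> x) \<in> A)"

end

(*
  Let W(n) = h^(n^sigma) M_n = (h n^tau)^(n^sigma). For 1 <= k <= n/2 the gap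
  n^sigma - k^sigma - (n-k)^sigma is at least a positive multiple of k n^(sigma-1), so that
  sum_{0<k<n} (n choose k) W(k) W(n-k) = o(W(n)) for every fixed h. By the Leibniz rule, the
  functions whose derivatives of order n are O(W(n)) on K therefore form an algebra, with the same h.
  If psi = 1/phi, the Leibniz rule for phi psi = 1 expresses a derivative of psi of order n through
  those of lower order, and because of the o(W(n)) a bound B W(m) for all m < n reproduces itself at
  n with the same B as soon as n is large. Hence h is preserved by inversion too, which settles the
  Roumieu and the Beurling case at once.
*)
theory Submission
  imports Defs "HOL-Real_Asymp.Real_Asymp"
begin

section \<open>Smooth functions and symmetry of mixed partial derivatives\<close>

text \<open>\<open>E_norm\<close> runs over multi-indices, for which the Leibniz rule carries
  products of binomial coefficients. Derivatives are therefore indexed by lists of directions: a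
  split of a list of length n hands each entry to one of the two factors, and once the terms are
  estimated by lengths only \<open>n choose k\<close> remains. The price is the symmetry of mixed
  partial derivatives, which makes the arbitrary succession inside \<open>multi_deriv\<close>
  harmless. In the recursion for psi, the term in which all derivatives fall on phi is bounded by a
  constant times W(n), which is not o(W(n)). It contains psi itself but none of its derivatives, so
  a large B absorbs it, while the o(W(n)) part is made to use only half of B. The finitely many
  small orders are covered by compactness of K.\<close>

lemma smooth_functions_continuous_on:
  "f \<in> smooth_functions U \<Longrightarrow> continuous_on U (iter_partial is f)"
  unfolding smooth_functions_def by blast

lemma smooth_functions_differentiable:
  "f \<in> smooth_functions U \<Longrightarrow> x \<in> U \<Longrightarrow>
    (\<lambda>t. iter_partial is f (x + t *\<^sub>R axis i 1)) differentiable (at 0)"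
  unfolding smooth_functions_def by blast

lemma iter_partial_append: "iter_partial (is @ js) f = iter_partial is (iter_partial js f)"
  by (induction "is") auto

lemma iter_partial_smooth:
  "f \<in> smooth_functions U \<Longrightarrow> iter_partial is f \<in> smooth_functions U"
  unfolding smooth_functions_def by (simp flip: iter_partial_append)

lemma smooth_functions_has_vector_derivative:
  assumes "f \<in> smooth_functions U" "x \<in> U"
  shows "((\<lambda>t. f (x + t *\<^sub>R axis i 1)) has_vector_derivative partial_deriv i f x) (at 0)"
  using smooth_functions_differentiable[OF assms, of "[]" i]
  by (simp add: vector_derivative_works partial_deriv_def)

text \<open>Smoothness speaks of the parameter 0 on the line through each point. Shifting the base
  point gives the derivative at every parameter, as a mean value estimate along a segment
  requires.\<close>

lemma smooth_functions_has_vector_derivative_line: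
  assumes "f \<in> smooth_functions U" "x + s *\<^sub>R axis i 1 \<in> U"
  shows "((\<lambda>t. f (x + t *\<^sub>R axis i 1)) has_vector_derivative
           partial_deriv i f (x + s *\<^sub>R axis i 1)) (at s within S)"
proof -
  let ?g = "\<lambda>t. f (x + s *\<^sub>R axis i 1 + t *\<^sub>R axis i 1)"
  have "((?g \<circ> (\<lambda>t. t - s)) has_vector_derivative
      1 *\<^sub>R partial_deriv i f (x + s *\<^sub>R axis i 1)) (at s)"
    using smooth_functions_has_vector_derivative[OF assms]
    by (intro vector_diff_chain_at) (auto intro!: derivative_eq_intros)
  then have "((\<lambda>t. f (x + t *\<^sub>R axis i 1)) has_vector_derivative
      partial_deriv i f (x + s *\<^sub>R axis i 1)) (at s)"
    by (simp add: o_def add.assoc flip: scaleR_left.add)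
  then show ?thesis by (rule has_vector_derivative_at_within)
qed

lemma partial_deriv_cong:
  assumes "open U" "x \<in> U" "\<And>y. y \<in> U \<Longrightarrow> f y = g y"
  shows "partial_deriv i f x = partial_deriv i g x"
proof -
  have "continuous_on UNIV (\<lambda>t::real. x + t *\<^sub>R axis i 1)" by (intro continuous_intros)
  then have "open ((\<lambda>t. x + t *\<^sub>R axis i 1) -` U)"
    using assms(1) by (simp add: continuous_on_open_vimage)
  then have "\<forall>\<^sub>F t in nhds (0::real). x + t *\<^sub>R axis i 1 \<in> U"
    using assms(2) eventually_nhds_in_open by fastforce
  then show ?thesis unfolding partial_deriv_def
    by (intro vector_derivative_cong_eq) (auto elim!: eventually_mono simp: assms(3))
qed

lemma differentiable_partial_cong:
  fixes f g :: "real ^ 'n \<Rightarrow> 'a::real_normed_field"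
  assumes "open U" "x \<in> U" "\<And>y. y \<in> U \<Longrightarrow> f y = g y"
    "(\<lambda>t. g (x + t *\<^sub>R axis i 1)) differentiable (at (0::real))"
  shows "(\<lambda>t. f (x + t *\<^sub>R axis i 1)) differentiable (at (0::real))"
proof -
  have "continuous_on UNIV (\<lambda>t::real. x + t *\<^sub>R axis i 1)" by (intro continuous_intros)
  then have op: "open ((\<lambda>t. x + t *\<^sub>R axis i 1) -` U)"
    using assms(1) by (simp add: continuous_on_open_vimage)
  from assms(4) obtain D where "((\<lambda>t. g (x + t *\<^sub>R axis i 1)) has_derivative D) (at (0::real))"
    by (auto simp: differentiable_def)
  then have "((\<lambda>t. f (x + t *\<^sub>R axis i 1)) has_derivative D) (at 0)"
    by (rule has_derivative_transform_within_open[OF _ op]) (auto simp: assms)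
  then show ?thesis by (auto simp: differentiable_def)
qed

section \<open>Closure of smooth functions under sums, products and reciprocals\<close>

text \<open>Every iterated derivative of \<open>f\<close> agrees on \<open>U\<close> with a member
  of \<open>S\<close>, so continuity and differentiability have to be checked on members only.
  Agreement on \<open>U\<close> survives differentiation because \<open>U\<close> is open; values
  outside \<open>U\<close> never matter.\<close>

lemma smooth_functions_coinduct:
  assumes U: "open U" and f: "f \<in> S"
    and cont: "\<And>f. f \<in> S \<Longrightarrow> continuous_on U f"
    and step: "\<And>f i. f \<in> S \<Longrightarrow> \<exists>g\<in>S. \<forall>x\<in>U.
      ((\<lambda>t. f (x + t *\<^sub>R axis i 1)) has_vector_derivative g x) (at 0)"
  shows "f \<in> smooth_functions U"
proof -
  have *: "\<exists>g\<in>S. \<forall>x\<in>U. iter_partial is f x = g x" for "is"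
  proof (induction "is")
    case (Cons i "is")
    then obtain g where g: "g \<in> S" "\<And>x. x \<in> U \<Longrightarrow> iter_partial is f x = g x" by auto
    obtain g' where g': "g' \<in> S" "\<And>x. x \<in> U \<Longrightarrow>
        ((\<lambda>t. g (x + t *\<^sub>R axis i 1)) has_vector_derivative g' x) (at 0)"
      using step[OF g(1)] by metis
    have "iter_partial (i # is) f x = g' x" if "x \<in> U" for x
    proof -
      have "partial_deriv i g x = g' x"
        unfolding partial_deriv_def by (rule vector_derivative_at[OF g'(2)[OF that]])
      then show ?thesis using partial_deriv_cong[OF U that g(2)] by simp
    qed
    then show ?case using g'(1) by blast
  qed (use f in auto)
  show ?thesis unfolding smooth_functions_def
  proof (intro CollectI allI conjI ballI)
    fix "is"
    obtain g where g: "g \<in> S" "\<And>x. x \<in> U \<Longrightarrow> iter_partial is f x = g x"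
      using * by blast
    show "continuous_on U (iter_partial is f)"
      using cont[OF g(1)] g(2) by (simp cong: continuous_on_cong)
    fix i x assume x: "x \<in> U"
    show "(\<lambda>t. iter_partial is f (x + t *\<^sub>R axis i 1)) differentiable (at 0)"
      using step[OF g(1)] x
      by (intro differentiable_partial_cong[OF U x g(2)]) (auto intro: differentiableI_vector)
  qed
qed

text \<open>
  This set is closed under partial differentiation on \<open>U\<close>, because the derivative of \<open>1 / f\<close> is
  \<open>- \<partial>\<^sub>i f * (1 / f) * (1 / f)\<close>. By coinduction all of its members are smooth.
\<close>

inductive_set smooth_hull :: "(real ^ 'n) set \<Rightarrow> (real ^ 'n \<Rightarrow> 'a::real_normed_field) set"
  for U where
  base: "f \<in> smooth_functions U \<Longrightarrow> f \<in> smooth_hull U"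
| const: "(\<lambda>x. c) \<in> smooth_hull U"
| inv: "f \<in> smooth_functions U \<Longrightarrow> (\<And>x. x \<in> U \<Longrightarrow> f x \<noteq> 0) \<Longrightarrow> (\<lambda>x. 1 / f x) \<in> smooth_hull U"
| add: "f \<in> smooth_hull U \<Longrightarrow> g \<in> smooth_hull U \<Longrightarrow> (\<lambda>x. f x + g x) \<in> smooth_hull U"
| mult: "f \<in> smooth_hull U \<Longrightarrow> g \<in> smooth_hull U \<Longrightarrow> (\<lambda>x. f x * g x) \<in> smooth_hull U"

lemma smooth_hull_continuous_on: "f \<in> smooth_hull U \<Longrightarrow> continuous_on U f"
proof (induction rule: smooth_hull.induct)
  case (base f)
  then show ?case using smooth_functions_continuous_on[of f U "[]"] by simp
next
  case (inv f)
  then show ?case using smooth_functions_continuous_on[of f U "[]"]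
    by (auto intro!: continuous_intros)
qed (auto intro!: continuous_intros)

lemma smooth_hull_has_partial_deriv:
  "f \<in> smooth_hull U \<Longrightarrow> \<exists>g\<in>smooth_hull U. \<forall>x\<in>U.
     ((\<lambda>t. f (x + t *\<^sub>R axis i 1)) has_vector_derivative g x) (at 0)"
proof (induction rule: smooth_hull.induct)
  case (base f)
  then show ?case
    using smooth_functions_has_vector_derivative iter_partial_smooth[of f U "[i]"]
    by (intro bexI[of _ "partial_deriv i f"]) (auto intro: smooth_hull.base)
next
  case (const c)
  show ?case by (intro bexI[of _ "\<lambda>_. 0"]) (auto intro: smooth_hull.const)
next
  case (inv f)
  \<comment> \<open>The sign is a constant factor, so that the closure rules of the hull apply to
    the whole expression.\<close>
  let ?g = "\<lambda>x. -1 * (partial_deriv i f x * (1 / f x * (1 / f x)))"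
  have "((\<lambda>t. 1 / f (x + t *\<^sub>R axis i 1)) has_vector_derivative ?g x) (at 0)" if "x \<in> U" for x
    using smooth_functions_has_vector_derivative[OF inv(1) that, of i] inv(2)[OF that]
    unfolding has_vector_derivative_def
    by (auto intro!: derivative_eq_intros simp: field_simps)
  moreover have "?g \<in> smooth_hull U"
    using inv iter_partial_smooth[OF inv(1), of "[i]"]
    by (intro smooth_hull.mult smooth_hull.const smooth_hull.inv) (auto intro: smooth_hull.base)
  ultimately show ?case by (intro bexI[of _ ?g]) auto
next
  case (add f g)
  then obtain f' g' where "f' \<in> smooth_hull U" "g' \<in> smooth_hull U"
    "\<forall>x\<in>U. ((\<lambda>t. f (x + t *\<^sub>R axis i 1)) has_vector_derivative f' x) (at 0)"
    "\<forall>x\<in>U. ((\<lambda>t. g (x + t *\<^sub>R axis i 1)) has_vector_derivative g' x) (at 0)" by blast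
  then show ?case
    by (intro bexI[of _ "\<lambda>x. f' x + g' x"]) (auto intro: smooth_hull.add has_vector_derivative_add)
next
  case (mult f g)
  then obtain f' g' where *: "f' \<in> smooth_hull U" "g' \<in> smooth_hull U"
    "\<forall>x\<in>U. ((\<lambda>t. f (x + t *\<^sub>R axis i 1)) has_vector_derivative f' x) (at 0)"
    "\<forall>x\<in>U. ((\<lambda>t. g (x + t *\<^sub>R axis i 1)) has_vector_derivative g' x) (at 0)" by blast
  have "((\<lambda>t. f (x + t *\<^sub>R axis i 1) * g (x + t *\<^sub>R axis i 1)) has_vector_derivative
      f x * g' x + f' x * g x) (at 0)" if "x \<in> U" for x
    using has_vector_derivative_mult[OF *(3)[rule_format, OF that] *(4)[rule_format, OF that]]
    by simp
  then show ?case using * mult.hyps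
    by (intro bexI[of _ "\<lambda>x. f x * g' x + f' x * g x"]) (auto intro: smooth_hull.intros)
qed

text \<open>Turns the introduction rules of the hull into closure properties of
  \<open>smooth_functions U\<close>.\<close>

lemma smooth_hull_eq:
  assumes "open U"
  shows "smooth_hull U = smooth_functions U"
proof
  show "smooth_hull U \<subseteq> smooth_functions U"
    using smooth_functions_coinduct[OF assms _ smooth_hull_continuous_on
        smooth_hull_has_partial_deriv] by blast
qed (auto intro: smooth_hull.base)

section \<open>Symmetry of mixed partial derivatives\<close>

text \<open>The mean value inequality, applied to \<open>f s - s *\<^sub>R c\<close>. An inequality
  replaces the mean value equation because the values are vectors.\<close>

lemma vector_mean_value_bound:
  fixes f :: "real \<Rightarrow> 'a::real_normed_vector"
  assumes r: "r \<ge> 0"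
    and f: "\<And>s. s \<in> {0..r} \<Longrightarrow> (f has_vector_derivative f' s) (at s within {0..r})"
    and B: "\<And>s. s \<in> {0..r} \<Longrightarrow> norm (f' s - c) \<le> B"
  shows "norm (f r - f 0 - r *\<^sub>R c) \<le> r * B"
proof -
  have "norm ((f r - r *\<^sub>R c) - (f 0 - 0 *\<^sub>R c)) \<le> B * norm (r - 0)"
  proof (rule differentiable_bound[where S = "{0..r}" and f' = "\<lambda>s h. h *\<^sub>R (f' s - c)"])
    show "((\<lambda>s. f s - s *\<^sub>R c) has_derivative (\<lambda>h. h *\<^sub>R (f' s - c))) (at s within {0..r})"
      if "s \<in> {0..r}" for s
      using f[OF that] unfolding has_vector_derivative_def
      by (auto intro!: derivative_eq_intros simp: algebra_simps)
    show "onorm (\<lambda>h. h *\<^sub>R (f' s - c)) \<le> B" if "s \<in> {0..r}" for s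
    proof (rule onorm_bound)
      show "0 \<le> B" using B[OF that] norm_ge_zero order_trans by blast
      show "norm (h *\<^sub>R (f' s - c)) \<le> B * norm h" for h
        using mult_left_mono[OF B[OF that], of "\<bar>h\<bar>"] by (simp add: mult.commute)
    qed
  qed (use r in auto)
  then show ?thesis using r by (simp add: algebra_simps)
qed

text \<open>The second difference is the increment over \<open>{0..r}\<close> of \<open>f (x + s
  *\<^sub>R axis i 1 + r *\<^sub>R axis j 1) - f (x + s *\<^sub>R axis i 1)\<close> as a function of
  \<open>s\<close>. Its derivative is in turn an increment of \<open>partial_deriv i f\<close> in
  direction \<open>j\<close>. The mean value bound is used for the inner increment with
  \<open>c\<close> and \<open>B\<close>, then for the outer one with \<open>r *\<^sub>R c\<close>
  and \<open>r * B\<close>.\<close>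

lemma second_difference_bound:
  fixes f :: "real ^ 'n \<Rightarrow> 'a::real_normed_field"
  assumes f: "f \<in> smooth_functions U" and r: "r \<ge> 0"
    and U: "\<And>s t. s \<in> {0..r} \<Longrightarrow> t \<in> {0..r} \<Longrightarrow> x + s *\<^sub>R axis i 1 + t *\<^sub>R axis j 1 \<in> U"
    and B: "\<And>s t. s \<in> {0..r} \<Longrightarrow> t \<in> {0..r} \<Longrightarrow>
      norm (partial_deriv j (partial_deriv i f) (x + s *\<^sub>R axis i 1 + t *\<^sub>R axis j 1) - c) \<le> B"
  shows "norm (f (x + r *\<^sub>R axis i 1 + r *\<^sub>R axis j 1) - f (x + r *\<^sub>R axis i 1)
      - f (x + r *\<^sub>R axis j 1) + f x - (r * r) *\<^sub>R c) \<le> r * r * B"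
proof -
  have f': "partial_deriv i f \<in> smooth_functions U" using iter_partial_smooth[OF f, of "[i]"] by simp
  have inner: "norm (partial_deriv i f (x + s *\<^sub>R axis i 1 + r *\<^sub>R axis j 1)
      - partial_deriv i f (x + s *\<^sub>R axis i 1) - r *\<^sub>R c) \<le> r * B" if "s \<in> {0..r}" for s
    using vector_mean_value_bound[OF r
        smooth_functions_has_vector_derivative_line[OF f' U[OF that]] B[OF that]] by simp
  have swap: "x + r *\<^sub>R axis j 1 + s *\<^sub>R axis i 1 = x + s *\<^sub>R axis i 1 + r *\<^sub>R axis j 1" for s
    by simp
  have "((\<lambda>s. f (x + s *\<^sub>R axis i 1 + r *\<^sub>R axis j 1) - f (x + s *\<^sub>R axis i 1))
      has_vector_derivative partial_deriv i f (x + s *\<^sub>R axis i 1 + r *\<^sub>R axis j 1)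
        - partial_deriv i f (x + s *\<^sub>R axis i 1)) (at s within {0..r})" if "s \<in> {0..r}" for s
    using smooth_functions_has_vector_derivative_line[OF f, of "x + r *\<^sub>R axis j 1" s i]
      smooth_functions_has_vector_derivative_line[OF f, of "x" s i] U[OF that, of r]
      U[OF that, of 0] r
    unfolding swap by (intro has_vector_derivative_diff) auto
  from vector_mean_value_bound[OF r this inner] show ?thesis
    by (simp add: algebra_simps)
qed

text \<open>The second difference over a square of side \<open>r\<close> is symmetric in
  \<open>i\<close> and \<open>j\<close>. Divided by \<open>r * r\<close> it is within
  \<open>e/2\<close> of either mixed derivative at \<open>x\<close> once \<open>r\<close> is small,
  by continuity of both.\<close>

lemma partial_deriv_commute:
  fixes f :: "real ^ 'n \<Rightarrow> 'a::real_normed_field"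
  assumes U: "open U" and f: "f \<in> smooth_functions U" and x: "x \<in> U"
  shows "partial_deriv i (partial_deriv j f) x = partial_deriv j (partial_deriv i f) x"
proof -
  have near: "\<exists>d>0. \<forall>r\<in>{0<..<d}. \<forall>s\<in>{0..r}. \<forall>t\<in>{0..r}.
      x + s *\<^sub>R axis i 1 + t *\<^sub>R axis j 1 \<in> U \<and>
      norm (g (x + s *\<^sub>R axis i 1 + t *\<^sub>R axis j 1) - g x) \<le> e"
    if "continuous_on U g" "e > 0" for g :: "real ^ 'n \<Rightarrow> 'a" and e :: real and i j
  proof -
    from that U x obtain d1 where d1: "d1 > 0" "\<And>y. dist y x < d1 \<Longrightarrow> dist (g y) (g x) < e"
      unfolding continuous_on_eq_continuous_at[OF U] continuous_at_eps_delta by blast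
    from U x obtain d2 where d2: "d2 > 0" "\<And>y. dist y x < d2 \<Longrightarrow> y \<in> U"
      by (auto simp: open_dist)
    define d where "d = min d1 d2"
    \<comment> \<open>The point is at distance at most \<open>s + t \<le> 2 * r\<close> from
      \<open>x\<close>, hence the bound \<open>d/2\<close> on the side of the square.\<close>
    have "dist (x + s *\<^sub>R axis i 1 + t *\<^sub>R axis j 1) x < d"
      if "r < d/2" "s \<in> {0..r}" "t \<in> {0..r}" for r s t
    proof -
      have "norm (s *\<^sub>R axis i (1::real) + t *\<^sub>R axis j 1) \<le> s + t"
        using that by (intro order_trans[OF norm_triangle_ineq]) (auto simp: norm_axis_1)
      then show ?thesis using that by (simp add: dist_norm add.assoc)
    qed
    moreover have "d > 0" using d1(1) d2(1) by (simp add: d_def)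
    moreover have "y \<in> U \<and> norm (g y - g x) \<le> e" if "dist y x < d" for y
      using d1(2)[of y] d2(2)[of y] that by (simp add: d_def dist_norm less_imp_le)
    ultimately show ?thesis
      by (intro exI[of _ "d/2"]) auto
  qed
  let ?a = "partial_deriv j (partial_deriv i f)" and ?b = "partial_deriv i (partial_deriv j f)"
  have cont: "continuous_on U ?a" "continuous_on U ?b"
    using smooth_functions_continuous_on[OF f, of "[j,i]"]
      smooth_functions_continuous_on[OF f, of "[i,j]"] by auto
  have "norm (?b x - ?a x) \<le> e" if e: "e > 0" for e
  proof -
    obtain d1 where d1: "d1 > 0" "\<forall>r\<in>{0<..<d1}. \<forall>s\<in>{0..r}. \<forall>t\<in>{0..r}.
      x + s *\<^sub>R axis i 1 + t *\<^sub>R axis j 1 \<in> U \<and>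
      norm (?a (x + s *\<^sub>R axis i 1 + t *\<^sub>R axis j 1) - ?a x) \<le> e/2"
      using near[OF cont(1) half_gt_zero[OF e], of i j] by blast
    obtain d2 where d2: "d2 > 0" "\<forall>r\<in>{0<..<d2}. \<forall>s\<in>{0..r}. \<forall>t\<in>{0..r}.
      x + s *\<^sub>R axis j 1 + t *\<^sub>R axis i 1 \<in> U \<and>
      norm (?b (x + s *\<^sub>R axis j 1 + t *\<^sub>R axis i 1) - ?b x) \<le> e/2"
      using near[OF cont(2) half_gt_zero[OF e], of j i] by blast
    define r where "r = min d1 d2 / 2"
    have r: "r > 0" "r < d1" "r < d2" using d1(1) d2(1) by (auto simp: r_def)
    define \<Delta> where "\<Delta> = f (x + r *\<^sub>R axis i 1 + r *\<^sub>R axis j 1) - f (x + r *\<^sub>R axis i 1)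
      - f (x + r *\<^sub>R axis j 1) + f x"
    have "norm (\<Delta> - (r * r) *\<^sub>R ?a x) \<le> r * r * (e/2)"
      unfolding \<Delta>_def using r d1 by (intro second_difference_bound[OF f]) auto
    moreover have "norm (f (x + r *\<^sub>R axis j 1 + r *\<^sub>R axis i 1) - f (x + r *\<^sub>R axis j 1)
      - f (x + r *\<^sub>R axis i 1) + f x - (r * r) *\<^sub>R ?b x) \<le> r * r * (e/2)"
      using r d2 by (intro second_difference_bound[OF f]) auto
    moreover have "f (x + r *\<^sub>R axis j 1 + r *\<^sub>R axis i 1) - f (x + r *\<^sub>R axis j 1)
      - f (x + r *\<^sub>R axis i 1) + f x = \<Delta>" by (simp add: \<Delta>_def algebra_simps)
    ultimately have "norm ((\<Delta> - (r * r) *\<^sub>R ?a x) - (\<Delta> - (r * r) *\<^sub>R ?b x)) \<le> r * r * e"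
      using norm_triangle_ineq4[of "\<Delta> - (r * r) *\<^sub>R ?a x" "\<Delta> - (r * r) *\<^sub>R ?b x"] by simp
    also have "(\<Delta> - (r * r) *\<^sub>R ?a x) - (\<Delta> - (r * r) *\<^sub>R ?b x) = (r * r) *\<^sub>R (?b x - ?a x)"
      by (simp add: algebra_simps)
    finally show ?thesis using r by (simp add: abs_mult)
  qed
  then show ?thesis using field_le_epsilon[of "norm (?b x - ?a x)" 0] by simp
qed

lemma iter_partial_cong:
  assumes "open U" "x \<in> U" "\<And>y. y \<in> U \<Longrightarrow> f y = g y"
  shows "iter_partial is f x = iter_partial is g x"
  using assms(2)
proof (induction "is" arbitrary: x)
  case (Cons i "is")
  then show ?case by (auto intro: partial_deriv_cong[OF assms(1)])
qed (use assms in auto)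

lemma iter_partial_move:
  assumes U: "open U" and f: "f \<in> smooth_functions U" and "x \<in> U"
  shows "iter_partial (is @ i # js) f x = iter_partial (i # is @ js) f x"
  using assms(3)
proof (induction "is" arbitrary: x)
  case (Cons k "is")
  have "iter_partial ((k # is) @ i # js) f x = partial_deriv k (iter_partial (i # is @ js) f) x"
    using Cons by (auto intro: partial_deriv_cong[OF U])
  also have "\<dots> = iter_partial (i # (k # is) @ js) f x"
    using partial_deriv_commute[OF U iter_partial_smooth[OF f] Cons.prems] by simp
  finally show ?case .
qed simp

text \<open>The head of the first list is located in the second and moved to its front; the
  remaining lists again have equal multisets.\<close>

lemma iter_partial_perm:
  assumes U: "open U" and f: "f \<in> smooth_functions U" and "x \<in> U"
    and "mset is = mset js"
  shows "iter_partial is f x = iter_partial js f x"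
  using assms(3,4)
proof (induction "is" arbitrary: js x)
  case (Cons i "is")
  from Cons.prems(2) have "i \<in> set js" by (metis list.set_intros(1) set_mset_mset)
  then obtain as bs where js: "js = as @ i # bs" by (meson split_list)
  with Cons.prems have "mset is = mset (as @ bs)" by simp
  then have "iter_partial (i # is) f x = iter_partial (i # as @ bs) f x"
    using Cons by (auto intro: partial_deriv_cong[OF U])
  then show ?case using iter_partial_move[OF U f Cons.prems(1)] js by simp
qed simp

section \<open>Multi-indices as lists of directions\<close>

lemma ex_list_count: "\<exists>is. \<forall>i::'n::finite. count_list is i = \<alpha> i"
proof -
  obtain "is" where "mset is = Abs_multiset \<alpha>" using ex_mset by blast
  then have "count (mset is) = \<alpha>" by (simp add: Abs_multiset_inverse)
  then show ?thesis by (metis count_mset)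
qed

lemma multi_order_count_list: "multi_order (count_list is) = length is"
  unfolding multi_order_def by (rule sum_count_set) auto

text \<open>The list picked by \<open>SOME\<close> is a permutation of \<open>is\<close>, so
  symmetry removes the dependence on the choice.\<close>

lemma multi_deriv_count_list:
  assumes "open U" "f \<in> smooth_functions U" "x \<in> U"
  shows "multi_deriv (count_list is) f x = iter_partial is f x"
proof -
  define js where "js = (SOME js. \<forall>i. count_list js i = count_list is i)"
  have "\<forall>i. count_list js i = count_list is i"
    unfolding js_def by (rule someI[of _ "is"]) simp
  then have "mset js = mset is" by (intro multiset_eqI) (simp add: count_mset)
  then have "iter_partial js f x = iter_partial is f x" by (rule iter_partial_perm[OF assms])
  then show ?thesis unfolding multi_deriv_def js_def .
qed

section \<open>The weight sequence\<close>

definition weight :: "real \<Rightarrow> real \<Rightarrow> real \<Rightarrow> nat \<Rightarrow> real" where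
  "weight \<tau> \<sigma> h n = h powr (real n powr \<sigma>) * M_seq \<tau> \<sigma> n"

lemma weight_0 [simp]: "h > 0 \<Longrightarrow> weight \<tau> \<sigma> h 0 = 1"
  by (simp add: weight_def M_seq_def)

lemma weight_eq:
  "h > 0 \<Longrightarrow> n > 0 \<Longrightarrow> weight \<tau> \<sigma> h n = (h * real n powr \<tau>) powr (real n powr \<sigma>)"
  by (simp add: weight_def M_seq_def powr_mult powr_powr)

lemma weight_pos: "h > 0 \<Longrightarrow> weight \<tau> \<sigma> h n > 0"
  by (cases "n = 0") (auto simp: weight_def M_seq_def)

lemma weight_nonneg: "h > 0 \<Longrightarrow> weight \<tau> \<sigma> h n \<ge> 0"
  using weight_pos by (rule less_imp_le)

lemma weight_mono: "0 < h \<Longrightarrow> h \<le> h' \<Longrightarrow> weight \<tau> \<sigma> h n \<le> weight \<tau> \<sigma> h' n"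
  unfolding weight_def by (intro mult_right_mono powr_mono2) (auto simp: M_seq_def)

text \<open>Write \<open>x powr \<sigma>\<close> as \<open>x * x powr (\<sigma> - 1)\<close> and
  bound the second factor by its value at \<open>n\<close> in the term for \<open>n - k\<close>, but
  at \<open>n / 2\<close> in the term for \<open>k\<close>. The latter saves the factor
  \<open>(1/2) powr (\<sigma> - 1)\<close>, which is below 1 since \<sigma> > 1.\<close>

lemma powr_superadditive_gap:
  fixes k n \<sigma> :: real
  assumes "\<sigma> > 1" "k > 0" "2 * k \<le> n"
  shows "k powr \<sigma> + (n - k) powr \<sigma> \<le>
    n powr \<sigma> - (1 - (1/2) powr (\<sigma> - 1)) * k * n powr (\<sigma> - 1)"
proof -
  have split: "x powr \<sigma> = x * x powr (\<sigma> - 1)" if "x > 0" for x :: real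
    using that by (simp add: powr_diff)
  have "(n - k) powr \<sigma> \<le> (n - k) * n powr (\<sigma> - 1)"
    using assms by (subst split) (auto intro!: mult_left_mono powr_mono2)
  moreover have "k powr \<sigma> \<le> k * (n / 2) powr (\<sigma> - 1)"
    using assms by (subst split) (auto intro!: mult_left_mono powr_mono2)
  moreover have "(n / 2) powr (\<sigma> - 1) = (1/2) powr (\<sigma> - 1) * n powr (\<sigma> - 1)"
    using assms by (simp add: powr_divide)
  moreover have "n powr \<sigma> = n * n powr (\<sigma> - 1)" using assms by (intro split) auto
  ultimately show ?thesis by (simp add: algebra_simps)
qed

text \<open>
  The gap in the exponent is at least a multiple of \<open>k n\<^bsup>\<sigma> - 1\<^esup>\<close>, so its contribution absorbs
  \<open>n choose k \<le> n ^ k\<close>.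
\<close>

lemma binomial_weight_le:
  assumes \<tau>: "\<tau> > 0" and \<sigma>: "\<sigma> > 1" and h: "h > 0" "h * real n powr \<tau> \<ge> 1"
    and k: "0 < k" "2 * k \<le> n"
  defines "q \<equiv> real n * (h * real n powr \<tau>) powr (-((1 - (1/2) powr (\<sigma> - 1)) * real n powr (\<sigma> - 1)))"
  assumes q: "q \<le> 1"
  shows "real (n choose k) * weight \<tau> \<sigma> h k * weight \<tau> \<sigma> h (n - k) \<le> q * weight \<tau> \<sigma> h n"
proof -
  let ?b = "h * real n powr \<tau>"
  define \<kappa> where "\<kappa> = 1 - (1/2) powr (\<sigma> - 1)"
  \<comment> \<open>Enlarging the base \<open>h * real m powr \<tau>\<close> to its value at
    \<open>n\<close> gives both weights a common base, so that their exponents add.\<close>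
  have le: "weight \<tau> \<sigma> h m \<le> ?b powr (real m powr \<sigma>)" if "m \<le> n" "m > 0" for m
    unfolding weight_eq[OF h(1) that(2)] using that h \<tau>
    by (intro powr_mono2) (auto intro!: powr_mono2)
  have "weight \<tau> \<sigma> h k * weight \<tau> \<sigma> h (n - k)
      \<le> ?b powr (real k powr \<sigma>) * ?b powr (real (n - k) powr \<sigma>)"
    using k by (intro mult_mono le) (auto simp: weight_nonneg h)
  also have "\<dots> = ?b powr (real k powr \<sigma> + (real n - real k) powr \<sigma>)"
    using k by (simp add: powr_add of_nat_diff)
  also have "\<dots> \<le> ?b powr (real n powr \<sigma> - \<kappa> * real k * real n powr (\<sigma> - 1))"
    unfolding \<kappa>_def using h k \<sigma> by (intro powr_mono powr_superadditive_gap) auto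
  also have "\<dots> = (?b powr (-(\<kappa> * real n powr (\<sigma> - 1)))) ^ k * weight \<tau> \<sigma> h n"
  proof -
    have "(?b powr (-(\<kappa> * real n powr (\<sigma> - 1)))) ^ k = ?b powr (real k * -(\<kappa> * real n powr (\<sigma> - 1)))"
      using k h by (intro powr_power) auto
    moreover have "weight \<tau> \<sigma> h n = ?b powr (real n powr \<sigma>)" using k by (intro weight_eq h) auto
    ultimately show ?thesis by (simp add: mult_ac flip: powr_add)
  qed
  finally have "weight \<tau> \<sigma> h k * weight \<tau> \<sigma> h (n - k)
      \<le> (?b powr (-(\<kappa> * real n powr (\<sigma> - 1)))) ^ k * weight \<tau> \<sigma> h n" .
  moreover have "real (n choose k) \<le> real n ^ k"
    using binomial_le_pow[of k n] k by (simp flip: of_nat_power)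
  ultimately have "real (n choose k) * (weight \<tau> \<sigma> h k * weight \<tau> \<sigma> h (n - k))
      \<le> real n ^ k * ((?b powr (-(\<kappa> * real n powr (\<sigma> - 1)))) ^ k * weight \<tau> \<sigma> h n)"
    by (intro mult_mono[where b = "real n ^ k"]) (auto simp: weight_nonneg h)
  also have "\<dots> = q ^ k * weight \<tau> \<sigma> h n" by (simp add: q_def \<kappa>_def power_mult_distrib)
  \<comment> \<open>Since \<open>0 \<le> q \<le> 1\<close> and \<open>k \<ge> 1\<close>, the power
    is at most \<open>q\<close>, a bound uniform in \<open>k\<close>.\<close>
  also have "\<dots> \<le> q * weight \<tau> \<sigma> h n"
    using q k h power_decreasing[of 1 k q] weight_pos[of h \<tau> \<sigma> n]
    by (intro mult_right_mono) (auto simp: q_def)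
  finally show ?thesis by (simp add: mult.assoc)
qed

text \<open>The logarithm of the power is -\<kappa> x^s log (h x^\<tau>), which outweighs any
  multiple of log x. The inner factor \<open>x\<close> comes from the binomial coefficient, the
  outer one will pay for the number of summands.\<close>

lemma binomial_weight_decay:
  fixes h \<tau> \<kappa> s :: real
  assumes "h > 0" "\<tau> > 0" "\<kappa> > 0" "s > 0"
  shows "((\<lambda>x::real. x * (x * (h * x powr \<tau>) powr (-(\<kappa> * x powr s)))) \<longlongrightarrow> 0) at_top"
    "filterlim (\<lambda>x::real. h * x powr \<tau>) at_top at_top"
  using assms by real_asymp+

text \<open>All summands share the bound \<open>q n * weight \<tau> \<sigma> h n\<close>: those with
  \<open>2 * k \<le> n\<close> directly, the others by exchanging \<open>k\<close> and
  \<open>n - k\<close>. There are fewer than \<open>n\<close> of them, and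
  \<open>real n * q n\<close> tends to 0. The end terms are left out because each equals the weight
  at \<open>n\<close>.\<close>

lemma weight_convolution_small:
  assumes \<tau>: "\<tau> > 0" and \<sigma>: "\<sigma> > 1" and h: "h > 0" and \<epsilon>: "\<epsilon> > 0"
  shows "\<forall>\<^sub>F n in sequentially.
    (\<Sum>k=1..<n. real (n choose k) * weight \<tau> \<sigma> h k * weight \<tau> \<sigma> h (n - k))
      \<le> \<epsilon> * weight \<tau> \<sigma> h n"
proof -
  define \<kappa> where "\<kappa> = 1 - (1/2::real) powr (\<sigma> - 1)"
  have "(1/2::real) powr (\<sigma> - 1) < 1" using \<sigma> powr_less_mono'[of "1/2" 0 "\<sigma> - 1"] by simp
  then have \<kappa>: "\<kappa> > 0" by (simp add: \<kappa>_def)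
  define q where "q n = real n * (h * real n powr \<tau>) powr (-(\<kappa> * real n powr (\<sigma> - 1)))" for n
  have "(\<lambda>n. real n * q n) \<longlonglongrightarrow> 0"
    unfolding q_def using \<sigma>
    by (intro filterlim_compose[OF binomial_weight_decay(1)[OF h \<tau> \<kappa>] filterlim_real_sequentially]) auto
  then have "\<forall>\<^sub>F n in sequentially. real n * q n < min \<epsilon> 1"
    using \<epsilon> by (intro order_tendstoD) auto
  moreover have "\<forall>\<^sub>F n in sequentially. h * real n powr \<tau> \<ge> 1"
    using filterlim_compose[OF binomial_weight_decay(2)[OF h \<tau> \<kappa> \<kappa>] filterlim_real_sequentially]
    unfolding filterlim_at_top by blast
  ultimately show ?thesis using eventually_gt_at_top[of 0]
  proof eventually_elim
    case (elim n)
    have q0: "q n \<ge> 0" by (simp add: q_def)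
    have "q n \<le> real n * q n" using elim(3) q0 mult_right_mono[of 1 "real n" "q n"] by simp
    then have q: "q n \<le> 1" using elim(1) by simp
    have half: "real (n choose k) * weight \<tau> \<sigma> h k * weight \<tau> \<sigma> h (n - k) \<le> q n * weight \<tau> \<sigma> h n"
      if "0 < k" "2 * k \<le> n" for k
      using binomial_weight_le[OF \<tau> \<sigma> h elim(2) that] q unfolding q_def \<kappa>_def by blast
    have "real (n choose k) * weight \<tau> \<sigma> h k * weight \<tau> \<sigma> h (n - k) \<le> q n * weight \<tau> \<sigma> h n"
      if k: "k \<in> {1..<n}" for k
    proof (cases "2 * k \<le> n")
      case False
      then have "real (n choose (n - k)) * weight \<tau> \<sigma> h (n - k) * weight \<tau> \<sigma> h (n - (n - k))
          \<le> q n * weight \<tau> \<sigma> h n"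
        using k by (intro half) auto
      then show ?thesis using k binomial_symmetric[of k n] by (simp add: mult_ac)
    qed (use half k in auto)
    then have "(\<Sum>k=1..<n. real (n choose k) * weight \<tau> \<sigma> h k * weight \<tau> \<sigma> h (n - k))
        \<le> real (card {1..<n}) * (q n * weight \<tau> \<sigma> h n)"
      by (intro sum_bounded_above) auto
    also have "\<dots> \<le> (real n * q n) * weight \<tau> \<sigma> h n"
      using q0 weight_pos[OF h, of \<tau> \<sigma> n]
      by (auto simp: mult.assoc intro!: mult_right_mono)
    also have "\<dots> \<le> \<epsilon> * weight \<tau> \<sigma> h n"
      using elim(1) weight_pos[OF h, of \<tau> \<sigma> n] by (intro mult_right_mono) auto
    finally show ?case .
  qed
qed

lemma weight_convolution_bounded:
  assumes \<tau>: "\<tau> > 0" and \<sigma>: "\<sigma> > 1" and h: "h > 0"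
  shows "\<exists>C>0. \<forall>n. (\<Sum>k\<le>n. real (n choose k) * weight \<tau> \<sigma> h k * weight \<tau> \<sigma> h (n - k))
    \<le> C * weight \<tau> \<sigma> h n"
proof -
  let ?W = "weight \<tau> \<sigma> h"
  define S where "S n = (\<Sum>k\<le>n. real (n choose k) * ?W k * ?W (n - k))" for n
  obtain N where N: "\<And>n. n \<ge> N \<Longrightarrow> (\<Sum>k=1..<n. real (n choose k) * ?W k * ?W (n - k)) \<le> 1 * ?W n"
    using weight_convolution_small[OF \<tau> \<sigma> h zero_less_one]
    unfolding eventually_sequentially by blast
  \<comment> \<open>For large \<open>n\<close> the two end terms contribute twice the weight and the
    middle at most once; the sum takes care of the finitely many remaining \<open>n\<close>.\<close>
  define C where "C = 3 + (\<Sum>n\<le>N. S n / ?W n)"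
  have S0: "S n / ?W n \<ge> 0" for n
    unfolding S_def by (intro divide_nonneg_nonneg sum_nonneg mult_nonneg_nonneg)
      (auto simp: weight_nonneg h)
  have "S n / ?W n \<le> C" for n
  proof (cases "n \<le> N")
    case True
    then have "S n / ?W n \<le> (\<Sum>n\<le>N. S n / ?W n)" using S0 by (intro member_le_sum) auto
    then show ?thesis by (simp add: C_def)
  next
    case False
    then have n: "n > 0" "n \<ge> N" by auto
    then have "{..n} = insert 0 (insert n {1..<n})" by auto
    then have "S n = 2 * ?W n + (\<Sum>k=1..<n. real (n choose k) * ?W k * ?W (n - k))"
      unfolding S_def using n h by simp
    then have "S n \<le> 3 * ?W n" using N[OF n(2)] by simp
    then have "S n / ?W n \<le> 3" using weight_pos[OF h] by (simp add: field_simps)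
    then show ?thesis unfolding C_def using S0 by (simp add: sum_nonneg add_increasing2)
  qed
  then have "S n \<le> C * ?W n" for n using weight_pos[OF h] by (simp add: field_simps)
  moreover have "C > 0" unfolding C_def using S0 by (simp add: sum_nonneg add_pos_nonneg)
  ultimately show ?thesis unfolding S_def by blast
qed

section \<open>The Leibniz rule\<close>

lemma iter_partial_const: "iter_partial is (\<lambda>_. c) = (\<lambda>_. if is = [] then c else 0)"
  by (induction "is") (auto simp: partial_deriv_def fun_eq_iff)

text \<open>All ways to distribute the entries over two factors, each side keeping its order.
  Coinciding pairs are repeated, so the Leibniz rule over this list has no coefficients.\<close>

primrec list_splits :: "'b list \<Rightarrow> ('b list \<times> 'b list) list" where
  "list_splits [] = [([], [])]"
| "list_splits (i # is) =
    map (apfst ((#) i)) (list_splits is) @ map (apsnd ((#) i)) (list_splits is)"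

text \<open>Isolates the one split that leaves the first factor undifferentiated; the Leibniz rule
  for a reciprocal is solved for this term.\<close>

lemma list_splits_snoc:
  "\<exists>ps. list_splits is = ps @ [([], is)] \<and>
    (\<forall>(a, b) \<in> set ps. a \<noteq> [] \<and> length a + length b = length is)"
proof (induction "is")
  case (Cons i "is")
  then obtain ps where "list_splits is = ps @ [([], is)]"
    "\<forall>(a, b) \<in> set ps. a \<noteq> [] \<and> length a + length b = length is" by blast
  then show ?case
    by (intro exI[of _ "map (apfst ((#) i)) (list_splits is) @ map (apsnd ((#) i)) ps"]) auto
qed simp

text \<open>Estimates depend on the lengths of the two parts only, and \<open>k\<close> entries go
  to the first part in \<open>length is choose k\<close> ways. The recursion of
  \<open>list_splits\<close> becomes Pascal's rule.\<close>

lemma sum_list_splits_length: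
  fixes F :: "nat \<Rightarrow> nat \<Rightarrow> 'a::comm_semiring_1"
  shows "(\<Sum>(a, b)\<leftarrow>list_splits is. F (length a) (length b)) =
    (\<Sum>k\<le>length is. of_nat (length is choose k) * F k (length is - k))"
proof (induction "is" arbitrary: F)
  case (Cons i "is")
  let ?n = "length is"
  have "(\<Sum>(a, b)\<leftarrow>list_splits (i # is). F (length a) (length b)) =
      (\<Sum>(a, b)\<leftarrow>list_splits is. F (Suc (length a)) (length b)) +
      (\<Sum>(a, b)\<leftarrow>list_splits is. F (length a) (Suc (length b)))"
    by (simp add: o_def case_prod_unfold)
  also have "\<dots> = (\<Sum>k\<le>?n. of_nat (?n choose k) * F (Suc k) (?n - k)) +
      (\<Sum>k\<le>?n. of_nat (?n choose k) * F k (Suc (?n - k)))"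
    using Cons[of "\<lambda>p q. F (Suc p) q"] Cons[of "\<lambda>p q. F p (Suc q)"] by simp
  \<comment> \<open>The added term \<open>k = Suc ?n\<close> vanishes, since its binomial
    coefficient is 0; this prepares the index shift.\<close>
  also have "(\<Sum>k\<le>?n. of_nat (?n choose k) * F k (Suc (?n - k))) =
      (\<Sum>k\<le>Suc ?n. of_nat (?n choose k) * F k (Suc ?n - k))"
    by (simp add: Suc_diff_le binomial_eq_0)
  also have "\<dots> = F 0 (Suc ?n) + (\<Sum>k\<le>?n. of_nat (?n choose Suc k) * F (Suc k) (?n - k))"
    by (subst sum.atMost_Suc_shift) simp
  also have "(\<Sum>k\<le>?n. of_nat (?n choose k) * F (Suc k) (?n - k)) + \<dots> =
      F 0 (Suc ?n) + (\<Sum>k\<le>?n. of_nat (Suc ?n choose Suc k) * F (Suc k) (?n - k))"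
    by (simp add: algebra_simps sum.distrib)
  also have "\<dots> = (\<Sum>k\<le>Suc ?n. of_nat (Suc ?n choose k) * F k (Suc ?n - k))"
    by (subst sum.atMost_Suc_shift) simp
  finally show ?case by simp
qed simp

lemma norm_sum_list_le: "norm (sum_list xs) \<le> (\<Sum>x\<leftarrow>xs. norm (x :: 'a::real_normed_vector))"
  by (induction xs) (auto intro: norm_triangle_mono)

lemma has_vector_derivative_sum_list:
  assumes "\<And>p. p \<in> set ps \<Longrightarrow> (F p has_vector_derivative F' p) net"
  shows "((\<lambda>t. \<Sum>p\<leftarrow>ps. F p t) has_vector_derivative (\<Sum>p\<leftarrow>ps. F' p)) net"
  using assms by (induction ps) (auto intro!: has_vector_derivative_add)

text \<open>The product rule sends the next direction to either factor of each term, exactly as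
  \<open>list_splits\<close> does. The induction hypothesis holds on all of the open set
  \<open>U\<close> and may therefore be differentiated.\<close>

lemma iter_partial_mult:
  assumes U: "open U" and f: "f \<in> smooth_functions U" and g: "g \<in> smooth_functions U"
    and "x \<in> U"
  shows "iter_partial is (\<lambda>y. f y * g y) x =
    (\<Sum>p\<leftarrow>list_splits is. iter_partial (fst p) f x * iter_partial (snd p) g x)"
  using assms(4)
proof (induction "is" arbitrary: x)
  case (Cons i "is")
  let ?F = "\<lambda>p y. iter_partial (fst p) f y * iter_partial (snd p) g y"
  let ?F' = "\<lambda>p. iter_partial (fst p) f x * iter_partial (i # snd p) g x +
    iter_partial (i # fst p) f x * iter_partial (snd p) g x"
  have "((\<lambda>t. ?F p (x + t *\<^sub>R axis i 1)) has_vector_derivative ?F' p) (at 0)" for p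
    using has_vector_derivative_mult[OF
        smooth_functions_has_vector_derivative[OF iter_partial_smooth[OF f] Cons.prems]
        smooth_functions_has_vector_derivative[OF iter_partial_smooth[OF g] Cons.prems]]
    by simp
  then have "((\<lambda>t. \<Sum>p\<leftarrow>list_splits is. ?F p (x + t *\<^sub>R axis i 1)) has_vector_derivative
      (\<Sum>p\<leftarrow>list_splits is. ?F' p)) (at 0)"
    by (intro has_vector_derivative_sum_list)
  then have "partial_deriv i (\<lambda>y. \<Sum>p\<leftarrow>list_splits is. ?F p y) x = (\<Sum>p\<leftarrow>list_splits is. ?F' p)"
    unfolding partial_deriv_def by (rule vector_derivative_at)
  moreover have "iter_partial (i # is) (\<lambda>y. f y * g y) x =
      partial_deriv i (\<lambda>y. \<Sum>p\<leftarrow>list_splits is. ?F p y) x"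
    using partial_deriv_cong[OF U Cons.prems Cons.IH] by simp
  ultimately show ?case by (simp add: sum_list_addf o_def add.commute)
qed simp

lemma iter_partial_add:
  assumes U: "open U" and f: "f \<in> smooth_functions U" and g: "g \<in> smooth_functions U"
    and "x \<in> U"
  shows "iter_partial is (\<lambda>y. f y + g y) x = iter_partial is f x + iter_partial is g x"
  using assms(4)
proof (induction "is" arbitrary: x)
  case (Cons i "is")
  have "partial_deriv i (\<lambda>y. iter_partial is f y + iter_partial is g y) x =
      partial_deriv i (iter_partial is f) x + partial_deriv i (iter_partial is g) x"
    unfolding partial_deriv_def[of i "\<lambda>y. iter_partial is f y + iter_partial is g y"]
    by (intro vector_derivative_at has_vector_derivative_add
        smooth_functions_has_vector_derivative[OF iter_partial_smooth[OF f] Cons.prems]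
        smooth_functions_has_vector_derivative[OF iter_partial_smooth[OF g] Cons.prems])
  then show ?case using partial_deriv_cong[OF U Cons.prems Cons.IH] by simp
qed simp

section \<open>Weighted bounds on derivatives\<close>

text \<open>Lists of directions and a real constant replace multi-indices and suprema in
  \<open>ennreal\<close>, so that the Leibniz rule applies directly.\<close>

definition weight_bounded ::
    "real \<Rightarrow> real \<Rightarrow> real \<Rightarrow> (real ^ 'n) set \<Rightarrow> (real ^ 'n \<Rightarrow> 'a::real_normed_field) \<Rightarrow> bool" where
  "weight_bounded \<tau> \<sigma> h K f \<longleftrightarrow>
    (\<exists>C. \<forall>is. \<forall>x\<in>K. norm (iter_partial is f x) \<le> C * weight \<tau> \<sigma> h (length is))"

lemma weight_boundedE:
  assumes "weight_bounded \<tau> \<sigma> h K f" "h > 0"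
  obtains C where "C > 0"
    "\<And>is x. x \<in> K \<Longrightarrow> norm (iter_partial is f x) \<le> C * weight \<tau> \<sigma> h (length is)"
proof -
  obtain C where C: "\<And>is x. x \<in> K \<Longrightarrow> norm (iter_partial is f x) \<le> C * weight \<tau> \<sigma> h (length is)"
    using assms(1) unfolding weight_bounded_def by blast
  have "C * weight \<tau> \<sigma> h n \<le> max C 1 * weight \<tau> \<sigma> h n" for n
    using weight_pos[OF assms(2), of \<tau> \<sigma> n] by (intro mult_right_mono) auto
  then show thesis using C by (intro that[of "max C 1"]) (auto intro: order_trans)
qed

text \<open>Every list determines a multi-index through \<open>count_list\<close>, every multi-index
  arises so, and by symmetry the derivatives agree. Hence the two conditions bound the same
  quantities.\<close>

lemma E_norm_finite_iff:
  fixes f :: "real ^ 'n \<Rightarrow> 'a::real_normed_field"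
  assumes U: "open U" and f: "f \<in> smooth_functions U" and K: "K \<subseteq> U" and h: "h > 0"
  shows "E_norm \<tau> \<sigma> h K f < \<infinity> \<longleftrightarrow> weight_bounded \<tau> \<sigma> h K f"
proof
  assume fin: "E_norm \<tau> \<sigma> h K f < \<infinity>"
  show "weight_bounded \<tau> \<sigma> h K f" unfolding weight_bounded_def
  proof (intro exI allI ballI)
    fix "is" :: "'n list" and x assume x: "x \<in> K"
    let ?w = "weight \<tau> \<sigma> h (length is)"
    have "ennreal (norm (multi_deriv (count_list is) f x) /
        (h powr (real (multi_order (count_list is)) powr \<sigma>) * M_seq \<tau> \<sigma> (multi_order (count_list is))))
        \<le> E_norm \<tau> \<sigma> h K f"
      unfolding E_norm_def 
      by (rule SUP_upper2[where i = "count_list is", OF UNIV_I],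
          rule SUP_upper2[where i = x, OF x], rule order_refl)
    then have "ennreal (norm (iter_partial is f x) / ?w) \<le> E_norm \<tau> \<sigma> h K f"
      using x K by (simp add: multi_order_count_list multi_deriv_count_list[OF U f] weight_def subset_iff)
    then have "norm (iter_partial is f x) / ?w \<le> enn2real (E_norm \<tau> \<sigma> h K f)"
      using fin weight_pos[OF h, of \<tau> \<sigma> "length is"] enn2real_mono by fastforce
    then show "norm (iter_partial is f x) \<le> enn2real (E_norm \<tau> \<sigma> h K f) * ?w"
      using weight_pos[OF h] by (simp add: pos_divide_le_eq)
  qed
next
  assume "weight_bounded \<tau> \<sigma> h K f"
  then obtain C where C: "C > 0"
    "\<And>is x. x \<in> K \<Longrightarrow> norm (iter_partial is f x) \<le> C * weight \<tau> \<sigma> h (length is)"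
    using h by (rule weight_boundedE) blast
  have "E_norm \<tau> \<sigma> h K f \<le> ennreal C" unfolding E_norm_def
  proof (intro SUP_least ennreal_leI)
    fix \<alpha> :: "'n \<Rightarrow> nat" and x assume x: "x \<in> K"
    obtain "is" where "\<forall>i. count_list is i = \<alpha> i" using ex_list_count[of \<alpha>] by blast
    then have is_def: "\<alpha> = count_list is" by auto
    show "norm (multi_deriv \<alpha> f x) /
        (h powr (real (multi_order \<alpha>) powr \<sigma>) * M_seq \<tau> \<sigma> (multi_order \<alpha>)) \<le> C"
      using C(2)[OF x, of "is"] K x weight_pos[OF h, of \<tau> \<sigma> "length is"] unfolding is_def
      by (simp add: multi_order_count_list multi_deriv_count_list[OF U f] subset_iff
          pos_divide_le_eq flip: weight_def)
  qed
  then show "E_norm \<tau> \<sigma> h K f < \<infinity>" using ennreal_less_top le_less_trans by (metis infinity_ennreal_def)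
qed

lemma weight_bounded_mono:
  assumes "weight_bounded \<tau> \<sigma> h K f" "0 < h" "h \<le> h'"
  shows "weight_bounded \<tau> \<sigma> h' K f"
proof -
  obtain C where C: "C > 0"
    "\<And>is x. x \<in> K \<Longrightarrow> norm (iter_partial is f x) \<le> C * weight \<tau> \<sigma> h (length is)"
    using weight_boundedE[OF assms(1,2)] by blast
  have "C * weight \<tau> \<sigma> h n \<le> C * weight \<tau> \<sigma> h' n" for n
    using C(1) weight_mono[OF assms(2,3)] by (intro mult_left_mono) auto
  then show ?thesis using C(2) unfolding weight_bounded_def by (blast intro: order_trans)
qed

lemma weight_bounded_const:
  assumes "h > 0"
  shows "weight_bounded \<tau> \<sigma> h K (\<lambda>_. c)"
  unfolding weight_bounded_def iter_partial_const using assms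
  by (intro exI[of _ "norm c"]) (auto simp: weight_nonneg)

lemma weight_bounded_add:
  assumes U: "open U" and f: "f \<in> smooth_functions U" and g: "g \<in> smooth_functions U"
    and K: "K \<subseteq> U"
    and bdd: "weight_bounded \<tau> \<sigma> h K f" "weight_bounded \<tau> \<sigma> h K g"
  shows "weight_bounded \<tau> \<sigma> h K (\<lambda>x. f x + g x)"
proof -
  obtain A B where "\<And>is x. x \<in> K \<Longrightarrow> norm (iter_partial is f x) \<le> A * weight \<tau> \<sigma> h (length is)"
    "\<And>is x. x \<in> K \<Longrightarrow> norm (iter_partial is g x) \<le> B * weight \<tau> \<sigma> h (length is)"
    using bdd unfolding weight_bounded_def by blast
  then show ?thesis using K unfolding weight_bounded_def
    by (intro exI[of _ "A + B"])
      (auto simp: iter_partial_add[OF U f g] subset_iff distrib_right intro!: norm_triangle_mono)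
qed

text \<open>Bounding each Leibniz term by the lengths of its split leaves the full binomial
  convolution of the weights, which is at most a constant times the weight.\<close>

lemma weight_bounded_mult:
  assumes U: "open U" and f: "f \<in> smooth_functions U" and g: "g \<in> smooth_functions U"
    and K: "K \<subseteq> U" and h: "h > 0" and \<tau>: "\<tau> > 0" and \<sigma>: "\<sigma> > 1"
    and bdd: "weight_bounded \<tau> \<sigma> h K f" "weight_bounded \<tau> \<sigma> h K g"
  shows "weight_bounded \<tau> \<sigma> h K (\<lambda>x. f x * g x)"
proof -
  let ?W = "weight \<tau> \<sigma> h"
  obtain A where A: "A > 0"
    "\<And>is x. x \<in> K \<Longrightarrow> norm (iter_partial is f x) \<le> A * ?W (length is)"
    using weight_boundedE[OF bdd(1) h] by blast
  obtain B where B: "B > 0"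
    "\<And>is x. x \<in> K \<Longrightarrow> norm (iter_partial is g x) \<le> B * ?W (length is)"
    using weight_boundedE[OF bdd(2) h] by blast
  obtain C where C: "\<And>n. (\<Sum>k\<le>n. real (n choose k) * ?W k * ?W (n - k)) \<le> C * ?W n"
    using weight_convolution_bounded[OF \<tau> \<sigma> h] by blast
  have "norm (iter_partial is (\<lambda>x. f x * g x) x) \<le> A * B * C * ?W (length is)"
    if x: "x \<in> K" for "is" x
  proof -
    have "norm (iter_partial is (\<lambda>x. f x * g x) x)
        \<le> (\<Sum>p\<leftarrow>list_splits is. norm (iter_partial (fst p) f x * iter_partial (snd p) g x))"
      using x K norm_sum_list_le[of "map (\<lambda>p. iter_partial (fst p) f x * iter_partial (snd p) g x) (list_splits is)"]
      by (simp add: iter_partial_mult[OF U f g] subset_iff o_def)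
    also have "\<dots> \<le> (\<Sum>p\<leftarrow>list_splits is.
        (A * B) * (?W (length (fst p)) * ?W (length (snd p))))"
    proof (rule sum_list_mono)
      fix p
      have "norm (iter_partial (fst p) f x) * norm (iter_partial (snd p) g x)
          \<le> (A * ?W (length (fst p))) * (B * ?W (length (snd p)))"
        using A B x by (intro mult_mono) (auto simp: weight_nonneg h)
      then show "norm (iter_partial (fst p) f x * iter_partial (snd p) g x)
          \<le> (A * B) * (?W (length (fst p)) * ?W (length (snd p)))"
        by (simp add: norm_mult mult_ac)
    qed
    also have "\<dots> = (\<Sum>k\<le>length is. real (length is choose k) *
        ((A * B) * (?W k * ?W (length is - k))))"
      using sum_list_splits_length[of "\<lambda>p q. (A * B) * (?W p * ?W q)" "is"]
      by (simp add: case_prod_unfold)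
    also have "\<dots> = A * B * (\<Sum>k\<le>length is. real (length is choose k) * ?W k * ?W (length is - k))"
      by (simp add: sum_distrib_left mult_ac)
    also have "\<dots> \<le> A * B * (C * ?W (length is))"
      using A B by (intro mult_left_mono C) auto
    finally show ?thesis by (simp add: mult_ac)
  qed
  then show ?thesis unfolding weight_bounded_def by blast
qed

text \<open>The Leibniz rule for \<open>\<phi> * \<psi> = 1\<close>, solved for the term in which every derivative falls on \<open>\<psi>\<close>.\<close>

lemma iter_partial_inverse_bound:
  fixes \<phi> :: "real ^ 'n \<Rightarrow> 'a::real_normed_field"
  assumes U: "open U" and \<phi>: "\<phi> \<in> smooth_functions U" and \<psi>: "\<psi> \<in> smooth_functions U"
    and inv: "\<And>y. y \<in> U \<Longrightarrow> \<phi> y * \<psi> y = 1" and x: "x \<in> U" and "is": "is \<noteq> []"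
    and a: "\<And>js. norm (iter_partial js \<phi> x) \<le> a (length js)"
    and b: "\<And>js. length js < length is \<Longrightarrow> norm (iter_partial js \<psi> x) \<le> b (length js)"
  shows "norm (\<phi> x) * norm (iter_partial is \<psi> x) \<le>
    (\<Sum>k=1..length is. real (length is choose k) * (a k * b (length is - k)))"
proof -
  let ?n = "length is"
  \<comment> \<open>There is a list of every length, so each \<open>a m\<close> dominates some
    norm.\<close>
  have a0: "a m \<ge> 0" for m
    using order_trans[OF norm_ge_zero a[of "replicate m undefined"]] by simp
  obtain ps where ps: "list_splits is = ps @ [([], is)]"
    "\<And>p. p \<in> set ps \<Longrightarrow> fst p \<noteq> [] \<and> length (fst p) + length (snd p) = ?n"
    using list_splits_snoc[of "is"] by fastforce
  let ?T = "\<lambda>p. iter_partial (fst p) \<phi> x * iter_partial (snd p) \<psi> x"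
  have "iter_partial is (\<lambda>y. \<phi> y * \<psi> y) x = iter_partial is (\<lambda>_. 1) x"
    by (intro iter_partial_cong[OF U x] inv)
  also have "\<dots> = 0" using "is" by (simp add: iter_partial_const)
  finally have "(\<Sum>p\<leftarrow>ps. ?T p) + \<phi> x * iter_partial is \<psi> x = 0"
    using iter_partial_mult[OF U \<phi> \<psi> x, of "is"] ps(1) by simp
  then have "(\<Sum>p\<leftarrow>ps. ?T p) = - (\<phi> x * iter_partial is \<psi> x)"
    by (simp only: eq_neg_iff_add_eq_0)
  then have "norm (\<phi> x) * norm (iter_partial is \<psi> x) = norm (\<Sum>p\<leftarrow>ps. ?T p)"
    by (simp only: norm_minus_cancel norm_mult)
  also have "\<dots> \<le> (\<Sum>p\<leftarrow>ps. norm (?T p))"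
    using norm_sum_list_le[of "map ?T ps"] by (simp add: o_def)
  also have "\<dots> \<le> (\<Sum>p\<leftarrow>ps. a (length (fst p)) * b (length (snd p)))"
  proof (rule sum_list_mono)
    fix p assume p: "p \<in> set ps"
    then have "length (snd p) < ?n" using ps(2)[OF p] by (cases "fst p") auto
    then show "norm (?T p) \<le> a (length (fst p)) * b (length (snd p))"
      unfolding norm_mult using a0 by (intro mult_mono a b) auto
  qed
  \<comment> \<open>The subtracted product belongs to the split \<open>([], is)\<close> missing from
    \<open>ps\<close>. It cancels the term \<open>k = 0\<close>, and with it \<open>b ?n\<close>,
    about which nothing is assumed.\<close>
  also have "\<dots> = (\<Sum>k\<le>?n. real (?n choose k) * (a k * b (?n - k))) - a 0 * b ?n"
    using sum_list_splits_length[of "\<lambda>p q. a p * b q" "is"] ps(1) by (simp add: case_prod_unfold)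
  also have "{..?n} = insert 0 {1..?n}" by auto
  finally show ?thesis by simp
qed

lemma weight_bounded_inverse:
  fixes \<phi> :: "real ^ 'n \<Rightarrow> 'a::real_normed_field"
  assumes U: "open U" and \<phi>: "\<phi> \<in> smooth_functions U" and \<psi>: "\<psi> \<in> smooth_functions U"
    and inv: "\<And>y. y \<in> U \<Longrightarrow> \<phi> y * \<psi> y = 1"
    and K: "compact K" "K \<subseteq> U" and h: "h > 0" and \<tau>: "\<tau> > 0" and \<sigma>: "\<sigma> > 1"
    and bdd: "weight_bounded \<tau> \<sigma> h K \<phi>"
  shows "weight_bounded \<tau> \<sigma> h K \<psi>"
proof -
  let ?W = "weight \<tau> \<sigma> h"
  obtain A where A: "A > 0"
    "\<And>is x. x \<in> K \<Longrightarrow> norm (iter_partial is \<phi> x) \<le> A * ?W (length is)"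
    using weight_boundedE[OF bdd h] by blast
  \<comment> \<open>Compactness bounds each derivative separately, with no uniformity in the order;
    this is enough for the finitely many orders up to \<open>N\<close>.\<close>
  have "\<exists>M. \<forall>x\<in>K. norm (iter_partial is \<psi> x) \<le> M" for "is"
  proof -
    have "compact (iter_partial is \<psi> ` K)"
      using smooth_functions_continuous_on[OF \<psi>] K
      by (intro compact_continuous_image) (auto intro: continuous_on_subset)
    then show ?thesis using compact_imp_bounded bounded_iff by (metis imageI)
  qed
  then obtain M where M: "\<And>is x. x \<in> K \<Longrightarrow> norm (iter_partial is \<psi> x) \<le> M is" by metis
  \<comment> \<open>The maximum with 1 secures \<open>c > 0\<close>, by which \<epsilon>
    divides.\<close>
  define c where "c = max 1 (M [])"
  have c: "c > 0" "\<And>x. x \<in> K \<Longrightarrow> norm (\<psi> x) \<le> c"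
    using M[of _ "[]"] by (auto simp: c_def le_max_iff_disj)
  \<comment> \<open>Chosen so that \<open>c * A * \<epsilon> = 1 / 2\<close>: the middle terms then
    return only half of \<open>B\<close>.\<close>
  define \<epsilon> where "\<epsilon> = 1 / (2 * A * c)"
  have \<epsilon>: "\<epsilon> > 0" using A c by (simp add: \<epsilon>_def)
  obtain N where N: "\<And>n. n \<ge> N \<Longrightarrow> (\<Sum>k=1..<n. real (n choose k) * ?W k * ?W (n - k)) \<le> \<epsilon> * ?W n"
    using weight_convolution_small[OF \<tau> \<sigma> h \<epsilon>] unfolding eventually_sequentially by blast
  define I :: "'n list set" where "I = {is. set is \<subseteq> UNIV \<and> length is \<le> N}"
  have I: "finite I" unfolding I_def by (intro finite_lists_length_le) simp
  \<comment> \<open>Half of the first summand absorbs the term in which all derivatives fall on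
    \<phi>, and the second summand starts the induction at all lists of length at most
    \<open>N\<close>, a finite set.\<close>
  define B where "B = 2 * A * c\<^sup>2 + (\<Sum>is\<in>I. \<bar>M is\<bar> / ?W (length is))"
  have sum0: "(\<Sum>is\<in>I. \<bar>M is\<bar> / ?W (length is)) \<ge> 0"
    by (intro sum_nonneg divide_nonneg_nonneg) (auto simp: weight_nonneg h)
  have B: "B \<ge> 2 * A * c\<^sup>2" "B \<ge> 0" using sum0 A by (auto simp: B_def)
  have "\<forall>x\<in>K. norm (iter_partial is \<psi> x) \<le> B * ?W (length is)" for "is"
  proof (induction "length is" arbitrary: "is" rule: less_induct)
    case less
    let ?n = "length is"
    show ?case
    proof (cases "?n \<le> N")
      case True
      then have "\<bar>M is\<bar> / ?W ?n \<le> (\<Sum>is\<in>I. \<bar>M is\<bar> / ?W (length is))"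
        using I by (intro member_le_sum) (auto simp: I_def weight_nonneg h)
      also have "\<dots> \<le> B" using A by (simp add: B_def)
      finally have "M is \<le> B * ?W ?n" using weight_pos[OF h] by (simp add: pos_divide_le_eq)
      then show ?thesis using M order_trans by blast
    next
      case False
      then have n: "is \<noteq> []" "?n > 0" "?n \<ge> N" by auto
      show ?thesis
      proof
        fix x assume x: "x \<in> K"
        \<comment> \<open>The value \<open>c\<close> at \<open>0\<close> instead of \<open>B\<close> makes the term \<open>k = length is\<close> independent of \<open>B\<close>.\<close>
        define b where "b m = (if m = 0 then c else B * ?W m)" for m
        have "norm (iter_partial js \<psi> x) \<le> b (length js)" if "length js < ?n" for js
          using less[OF that] x c(2) by (auto simp: b_def)
        then have "norm (\<phi> x) * norm (iter_partial is \<psi> x)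
            \<le> (\<Sum>k=1..?n. real (?n choose k) * ((A * ?W k) * b (?n - k)))"
          using x K A(2)[OF x] by (intro iter_partial_inverse_bound[OF U \<phi> \<psi> inv _ n(1)]) auto
        also have "{1..?n} = insert ?n {1..<?n}" using n by (auto simp: Suc_le_eq)
        also have "(\<Sum>k\<in>insert ?n {1..<?n}. real (?n choose k) * ((A * ?W k) * b (?n - k)))
            = A * c * ?W ?n + A * B * (\<Sum>k=1..<?n. real (?n choose k) * ?W k * ?W (?n - k))"
          by (simp add: b_def sum_distrib_left mult_ac)
        also have "\<dots> \<le> A * c * ?W ?n + A * B * (\<epsilon> * ?W ?n)"
          using A B by (intro add_left_mono mult_left_mono N n) auto
        \<comment> \<open>Instead of dividing by \<open>norm (\<phi> x)\<close>, multiply by its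
          reciprocal \<open>norm (\<psi> x)\<close>, which is at most \<open>c\<close> on
          \<open>K\<close>.\<close>
        finally have "norm (\<psi> x) * (norm (\<phi> x) * norm (iter_partial is \<psi> x))
            \<le> c * (A * c * ?W ?n + A * B * (\<epsilon> * ?W ?n))"
          using c x by (intro mult_mono) auto
        moreover have "norm (\<psi> x) * norm (\<phi> x) = 1"
          using inv[of x] x K by (metis mult.commute norm_mult norm_one subsetD)
        ultimately have "norm (iter_partial is \<psi> x) \<le> c * (A * c * ?W ?n + A * B * (\<epsilon> * ?W ?n))"
          by (simp flip: mult.assoc)
        also have "\<dots> = (A * c\<^sup>2 + B / 2) * ?W ?n"
          using A c by (simp add: \<epsilon>_def field_simps power2_eq_square)
        also have "\<dots> \<le> B * ?W ?n"
          using B weight_pos[OF h, of \<tau> \<sigma> ?n] by (intro mult_right_mono) auto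
        finally show "norm (iter_partial is \<psi> x) \<le> B * ?W ?n" .
      qed
    qed
  qed
  then show ?thesis unfolding weight_bounded_def by blast
qed

section \<open>The Roumieu and Beurling classes\<close>

lemma E_Roumieu_iff:
  assumes "open U"
  shows "f \<in> E_Roumieu \<tau> \<sigma> U \<longleftrightarrow> f \<in> smooth_functions U \<and>
    (\<forall>K. compact K \<and> K \<subseteq> U \<longrightarrow> (\<exists>h>0. weight_bounded \<tau> \<sigma> h K f))"
  unfolding E_Roumieu_def by (auto simp: E_norm_finite_iff[OF assms] simp del: infinity_ennreal_def cong: conj_cong)

lemma E_Beurling_iff:
  assumes "open U"
  shows "f \<in> E_Beurling \<tau> \<sigma> U \<longleftrightarrow> f \<in> smooth_functions U \<and>
    (\<forall>K. compact K \<and> K \<subseteq> U \<longrightarrow> (\<forall>h>0. weight_bounded \<tau> \<sigma> h K f))"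
  unfolding E_Beurling_def by (auto simp: E_norm_finite_iff[OF assms] simp del: infinity_ennreal_def)

text \<open>Once constants belong to \<open>A\<close>, the zero function is one of them and scalar
  multiples are products.\<close>

lemma inverse_closedI:
  fixes A :: "(real ^ 'n \<Rightarrow> 'a::real_normed_field) set"
  assumes "A \<subseteq> smooth_functions U" "\<And>c. (\<lambda>_. c) \<in> A"
    and "\<And>f g. f \<in> A \<Longrightarrow> g \<in> A \<Longrightarrow> (\<lambda>x. f x + g x) \<in> A"
    and "\<And>f g. f \<in> A \<Longrightarrow> g \<in> A \<Longrightarrow> (\<lambda>x. f x * g x) \<in> A"
    and "\<And>f. f \<in> A \<Longrightarrow> (\<And>x. x \<in> U \<Longrightarrow> f x \<noteq> 0) \<Longrightarrow> (\<lambda>x. 1 / f x) \<in> A"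
  shows "inverse_closed_in_smooth U A"
  unfolding inverse_closed_in_smooth_def function_algebra_def
  using assms(1) assms(2)[of 0] assms(3) assms(4)[OF assms(2)] assms(4,5) by auto

theorem corollary2p1:
  fixes U :: "(real ^ 'n) set" and \<tau> \<sigma> :: real
  assumes "open U" and "\<tau> > 0" and "\<sigma> > 1"
  shows "inverse_closed_in_smooth U (E_Roumieu \<tau> \<sigma> U :: (real ^ 'n \<Rightarrow> 'a::real_normed_field) set)
       \<and> inverse_closed_in_smooth U (E_Beurling \<tau> \<sigma> U :: (real ^ 'n \<Rightarrow> 'a) set)"
proof
  note U = \<open>open U\<close>
  note hull = smooth_hull_eq[OF U]
  have smooth_const: "(\<lambda>_. c) \<in> smooth_functions U" for c :: 'a
    using smooth_hull.const hull by blast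
  have smooth_add: "(\<lambda>x. f x + g x) \<in> smooth_functions U"
    and smooth_mult: "(\<lambda>x. f x * g x) \<in> smooth_functions U"
    if "f \<in> smooth_functions U" "g \<in> smooth_functions U" for f g :: "real ^ 'n \<Rightarrow> 'a"
    using smooth_hull.add[of f U g] smooth_hull.mult[of f U g] that hull by auto
  have smooth_inv: "(\<lambda>x. 1 / f x) \<in> smooth_functions U"
    if "f \<in> smooth_functions U" "\<And>x. x \<in> U \<Longrightarrow> f x \<noteq> 0" for f :: "real ^ 'n \<Rightarrow> 'a"
    using smooth_hull.inv[OF that] hull by auto
  have bounded_inv: "weight_bounded \<tau> \<sigma> h K (\<lambda>x. 1 / f x)"
    if "f \<in> smooth_functions U" "\<And>x. x \<in> U \<Longrightarrow> f x \<noteq> 0" "compact K" "K \<subseteq> U" "h > 0"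
      "weight_bounded \<tau> \<sigma> h K f" for f :: "real ^ 'n \<Rightarrow> 'a" and h K
    using that assms by (intro weight_bounded_inverse[OF U that(1) smooth_inv]) auto
  \<comment> \<open>Each of the two functions brings its own parameter on \<open>K\<close>. The
    weights increase with \<open>h\<close>, so the larger parameter serves both.\<close>
  have common: "\<exists>h>0. weight_bounded \<tau> \<sigma> h K f \<and> weight_bounded \<tau> \<sigma> h K g"
    if fg: "f \<in> E_Roumieu \<tau> \<sigma> U" "g \<in> E_Roumieu \<tau> \<sigma> U" and K: "compact K" "K \<subseteq> U"
    for f g :: "real ^ 'n \<Rightarrow> 'a" and K
  proof -
    obtain h1 h2 where h: "h1 > 0" "h2 > 0"
      and b: "weight_bounded \<tau> \<sigma> h1 K f" "weight_bounded \<tau> \<sigma> h2 K g"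
      using fg K unfolding E_Roumieu_iff[OF U] by blast
    show ?thesis
      using weight_bounded_mono[OF b(1) h(1), of "max h1 h2"]
        weight_bounded_mono[OF b(2) h(2), of "max h1 h2"] h
      by (intro exI[of _ "max h1 h2"]) auto
  qed
  show "inverse_closed_in_smooth U (E_Roumieu \<tau> \<sigma> U :: (real ^ 'n \<Rightarrow> 'a) set)"
  proof (rule inverse_closedI)
    fix f g :: "real ^ 'n \<Rightarrow> 'a"
    assume fg: "f \<in> E_Roumieu \<tau> \<sigma> U" "g \<in> E_Roumieu \<tau> \<sigma> U"
    then have s: "f \<in> smooth_functions U" "g \<in> smooth_functions U" by (auto simp: E_Roumieu_iff[OF U])
    show "(\<lambda>x. f x + g x) \<in> E_Roumieu \<tau> \<sigma> U"
      unfolding E_Roumieu_iff[OF U]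
      using common[OF fg] weight_bounded_add[OF U s] smooth_add[OF s] by metis
    show "(\<lambda>x. f x * g x) \<in> E_Roumieu \<tau> \<sigma> U"
      unfolding E_Roumieu_iff[OF U]
      using common[OF fg] weight_bounded_mult[OF U s _ _ assms(2,3)] smooth_mult[OF s] by metis
  next
    fix f :: "real ^ 'n \<Rightarrow> 'a"
    assume "f \<in> E_Roumieu \<tau> \<sigma> U" "\<And>x. x \<in> U \<Longrightarrow> f x \<noteq> 0"
    then show "(\<lambda>x. 1 / f x) \<in> E_Roumieu \<tau> \<sigma> U"
      unfolding E_Roumieu_iff[OF U] using smooth_inv[of f] bounded_inv[of f] by blast
  next
    fix c :: 'a
    show "(\<lambda>_. c) \<in> E_Roumieu \<tau> \<sigma> U"
      unfolding E_Roumieu_iff[OF U]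
      using smooth_const weight_bounded_const[OF zero_less_one] zero_less_one by blast
  qed (simp add: E_Roumieu_iff[OF U] subset_iff)
  show "inverse_closed_in_smooth U (E_Beurling \<tau> \<sigma> U :: (real ^ 'n \<Rightarrow> 'a) set)"
  proof (rule inverse_closedI)
    fix f g :: "real ^ 'n \<Rightarrow> 'a"
    assume fg: "f \<in> E_Beurling \<tau> \<sigma> U" "g \<in> E_Beurling \<tau> \<sigma> U"
    then have s: "f \<in> smooth_functions U" "g \<in> smooth_functions U" by (auto simp: E_Beurling_iff[OF U])
    show "(\<lambda>x. f x + g x) \<in> E_Beurling \<tau> \<sigma> U"
      using fg weight_bounded_add[OF U s] smooth_add[OF s] by (simp add: E_Beurling_iff[OF U])
    show "(\<lambda>x. f x * g x) \<in> E_Beurling \<tau> \<sigma> U"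
      using fg weight_bounded_mult[OF U s _ _ assms(2,3)] smooth_mult[OF s]
      by (simp add: E_Beurling_iff[OF U])
  next
    fix f :: "real ^ 'n \<Rightarrow> 'a"
    assume "f \<in> E_Beurling \<tau> \<sigma> U" "\<And>x. x \<in> U \<Longrightarrow> f x \<noteq> 0"
    then show "(\<lambda>x. 1 / f x) \<in> E_Beurling \<tau> \<sigma> U"
      using smooth_inv[of f] bounded_inv[of f] by (simp add: E_Beurling_iff[OF U])
  next
    fix c :: 'a
    show "(\<lambda>_. c) \<in> E_Beurling \<tau> \<sigma> U"
      by (simp add: E_Beurling_iff[OF U] smooth_const weight_bounded_const)
  qed (simp add: E_Beurling_iff[OF U] subset_iff)
qed

end
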